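(* Consider the problem of minimizing $F=f+\psi$ and the inexact variable-metric block-coordinate descent algorithm (Algorithm A) described in the context. Assume that $f$ and $\psi$ are convex, that $f$ satisfies the blockwise Lipschitz condition with constants $L_1,\dots,L_N>0$, and that for some $\mu>0$ the quadratic growth condition $$F(x)-F^*\ge\frac{\mu}{2}\|x-P_\Omega(x)\|^2\quad\text{for all }x$$ holds. Suppose that at the $k$th iteration of Algorithm A, the $\eta$-approximate solution condition $\eta(Q^k_i(0)-Q^{k*}_i)\ge Q^k_i(d^k_i)-Q^{k*}_i$ is satisfied with some $\eta\in[0,1)$, and $H^k_i\succeq m_iI$ for some $m_i>0$, for all $i=1,\dots,N$ (so that the line-search step sizes $\alpha^k_i$ are all bounded away from $0$). Given any probability distribution $\{p^k_i\}_{i=1}^N>0$ for choosing the block, let $\pi^k:=\min_{1\le i\le N}\alpha^k_ip^k_i$, $\mathcal P_k:=\mathrm{diag}(p^k_1I_{n_1},\dots,p^k_NI_{n_N})$, $\mathcal A_k:=\mathrm{diag}(\alpha^k_1I_{n_1},\dots,\alpha^k_NI_{n_N})$, $\mathcal H_k:=\mathrm{diag}(H^k_1,\dots,H^k_N)$. If $F(x^k)>F^*$, then $$\frac{\mathbb E_{i_k}[F(x^{k+1})-F^*\mid x^k]}{F(x^k)-F^*}\le1-(1-\eta)\gamma\rho_k,$$ where $\rho_k$ is bounded below by $$\frac{\mu}{4\|\mathcal P_k^{-1}\mathcal A_k^{-1}\mathcal H_k\|}\quad\text{if }\ \frac{\mu}{2\|\mathcal P_k^{-1}\mathcal A_k^{-1}\mathcal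 H_k\|\pi^k}\le1,$$ and by $$\pi^k\Big(1-\frac{\pi^k\|\mathcal P_k^{-1}\mathcal A_k^{-1}\mathcal H_k\|}{\mu}\Big)\quad\text{otherwise}.$$
   Context: Problem. Minimize $F(x)=f(x)+\psi(x)$ over $x\in\mathbb R^n$, where $x=(x_1,\dots,x_N)$ is split into $N$ blocks $x_i\in\mathbb R^{n_i}$, $\sum_i n_i=n$. $U_i\in\mathbb R^{n\times n_i}$ is the column submatrix of the identity with $x_i=U_i^\top x$; $\nabla_if:=U_i^\top\nabla f$. $f:\mathbb R^n\to\mathbb R$ is continuously differentiable and blockwise Lipschitz: $\|\nabla_if(x+U_ih)-\nabla_if(x)\|\le L_i\|h\|$ for all $x\in\mathbb R^n$, $h\in\mathbb R^{n_i}$, with $L_i>0$. $\psi(x)=\sum_i\psi_i(x_i)$ with each $\psi_i$ convex, extended-valued, proper and closed. $F$ is bounded below and its set of minimizers $\Omega$ is nonempty; $F^*$ is the minimum value; $P_\Omega$ is the Euclidean projection onto $\Omega$. $\|\cdot\|$ is the Euclidean norm for vectors and the spectral norm for matrices. Algorithm A. Given $\beta,\gamma\in(0,1)$, $\eta\in[0,1)$, $x^0$ with $F(x^0)<\infty$. At iteration $k=0,1,2,\dots$: pick a probability distribution $p^k_1,\dots,p^k_N>0$, $\sum_ip^k_i=1$, and sample $i_k$ from it. For a block $i$, with a symmetric positive-definite matrix $H^k_i\in\mathbb R^{n_i\times n_i}$, let $$Q^k_i(d_i):=\nabla_if(x^k)^\top d_i+\tfrac12d_i^\top H^k_id_i+\psi_i(x^k_i+d_i)-\psi_i(x^k_i),\qquad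 Q^{k*}_i:=\inf_{d_i}Q^k_i(d_i).$$ For $i=i_k$, compute an $\eta$-approximate minimizer $d^k_i$ of $Q^k_i$, i.e. $\eta(Q^k_i(0)-Q^{k*}_i)\ge Q^k_i(d^k_i)-Q^{k*}_i$. With $\Delta^k_i:=\nabla_if(x^k)^\top d^k_i+\psi_i(x^k_i+d^k_i)-\psi_i(x^k_i)$, let $\alpha^k_i$ be the largest value in $\{1,\beta,\beta^2,\dots\}$ with $F(x^k+\alpha^k_iU_id^k_i)\le F(x^k)+\alpha^k_i\gamma\Delta^k_i$. Set $x^{k+1}=x^k+\alpha^k_{i_k}U_{i_k}d^k_{i_k}$. Conventions. At each iteration, $H^k_i,d^k_i,\alpha^k_i$ are considered for every $i=1,\dots,N$ as the quantities that would result if $i$ were chosen as $i_k$. $\mathbb E_{i_k}[\cdot\mid x^k]$ is the expectation over $i_k$ (distributed according to $\{p^k_i\}$) with everything up to iteration $k$ fixed. "The inequality holds where $\rho_k$ is bounded below by $c$" means the inequality holds for some number $\rho_k\ge c$. *)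

theory Defs
  imports "HOL-Analysis.Analysis" "HOL-Probability.Probability"
begin

text \<open>
  The splitting of \<^typ>\<open>real^'n\<close> into blocks is given by a map \<open>blk :: 'n \<Rightarrow> 'b\<close> that assigns to
  each coordinate its block; \<open>n\<^sub>i\<close> is the number of coordinates in block \<open>i\<close>.  The block space
  of dimension \<open>n\<^sub>i\<close> is identified with its isometric image under \<open>U\<^sub>i\<close>, that is, with the vectors
  of \<^typ>\<open>real^'n\<close> supported on block \<open>i\<close>.  Accordingly \<open>U\<^sub>i\<close> itself is suppressed, the
  restriction \<open>U\<^sub>i\<^sup>T x\<close> becomes the orthogonal projection \<open>block_part blk i x\<close> (which is
  \<open>U\<^sub>i U\<^sub>i\<^sup>T x\<close>), and an \<open>n\<^sub>i \<times> n\<^sub>i\<close> matrix \<open>M\<close> becomes the \<open>n \<times> n\<close> matrix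
  \<open>U\<^sub>i M U\<^sub>i\<^sup>T\<close>, which vanishes outside the rows and columns of block \<open>i\<close>.
\<close>

definition block_space :: "('n::finite \<Rightarrow> 'b) \<Rightarrow> 'b \<Rightarrow> (real^'n) set" where
  "block_space blk i = {v. \<forall>j. blk j \<noteq> i \<longrightarrow> v $ j = 0}"

definition block_part :: "('n::finite \<Rightarrow> 'b) \<Rightarrow> 'b \<Rightarrow> real^'n \<Rightarrow> real^'n" where
  "block_part blk i x = (\<chi> j. if blk j = i then x $ j else 0)"

definition block_matrix :: "('n::finite \<Rightarrow> 'b) \<Rightarrow> 'b \<Rightarrow> real^'n^'n \<Rightarrow> bool" where
  "block_matrix blk i M \<longleftrightarrow> (\<forall>r c. \<not> (blk r = i \<and> blk c = i) \<longrightarrow> M $ r $ c = 0)"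

definition block_posdef :: "('n::finite \<Rightarrow> 'b) \<Rightarrow> 'b \<Rightarrow> real^'n^'n \<Rightarrow> bool" where
  "block_posdef blk i M \<longleftrightarrow> (\<forall>d\<in>block_space blk i - {0}. 0 < d \<bullet> (M *v d))"

definition block_psd :: "('n::finite \<Rightarrow> 'b) \<Rightarrow> 'b \<Rightarrow> real^'n^'n \<Rightarrow> bool" where
  "block_psd blk i M \<longleftrightarrow> (\<forall>d\<in>block_space blk i. 0 \<le> d \<bullet> (M *v d))"

text \<open>
  The block-diagonal matrix with diagonal blocks \<open>B i\<close>.  Only the entries of \<open>B i\<close> in the rows
  and columns of block \<open>i\<close> are used, so \<open>mat 1\<close> may stand for the identity of any block.
\<close>

definition block_diag :: "('n::finite \<Rightarrow> 'b) \<Rightarrow> ('b \<Rightarrow> real^'n^'n) \<Rightarrow> real^'n^'n" where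
  "block_diag blk B = (\<chi> r c. if blk r = blk c then B (blk r) $ r $ c else 0)"

definition spectral_norm :: "real^'n^'m \<Rightarrow> real" where
  "spectral_norm M = onorm ((*v) M)"

text \<open>Convexity and closedness of an extended-valued function on \<open>S\<close>, through its epigraph.\<close>

definition ext_epigraph :: "'a set \<Rightarrow> ('a \<Rightarrow> ereal) \<Rightarrow> ('a \<times> real) set" where
  "ext_epigraph S \<phi> = {(v, r). v \<in> S \<and> \<phi> v \<le> ereal r}"

definition proper_on :: "'a set \<Rightarrow> ('a \<Rightarrow> ereal) \<Rightarrow> bool" where
  "proper_on S \<phi> \<longleftrightarrow> (\<forall>v\<in>S. \<phi> v \<noteq> -\<infinity>) \<and> (\<exists>v\<in>S. \<phi> v \<noteq> \<infinity>)"

definition closed_convex_proper_on :: "'a::euclidean_space set \<Rightarrow> ('a \<Rightarrow> ereal) \<Rightarrow> bool" where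
  "closed_convex_proper_on S \<phi> \<longleftrightarrow>
     convex (ext_epigraph S \<phi>) \<and> closed (ext_epigraph S \<phi>) \<and> proper_on S \<phi>"

definition objective ::
  "('n::finite \<Rightarrow> 'b::finite) \<Rightarrow> (real^'n \<Rightarrow> real) \<Rightarrow> ('b \<Rightarrow> real^'n \<Rightarrow> ereal) \<Rightarrow> real^'n \<Rightarrow> ereal" where
  "objective blk f \<psi> x = ereal (f x) + (\<Sum>i\<in>UNIV. \<psi> i (block_part blk i x))"

definition minimizers :: "('a \<Rightarrow> ereal) \<Rightarrow> 'a set" where
  "minimizers F = {x. \<forall>y. F x \<le> F y}"

definition min_value :: "('a \<Rightarrow> ereal) \<Rightarrow> ereal" where
  "min_value F = (INF x. F x)"

definition blockwise_lipschitz ::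
  "('n::finite \<Rightarrow> 'b) \<Rightarrow> (real^'n \<Rightarrow> real^'n) \<Rightarrow> ('b \<Rightarrow> real) \<Rightarrow> bool" where
  "blockwise_lipschitz blk g L \<longleftrightarrow>
     (\<forall>i x. \<forall>h\<in>block_space blk i.
        norm (block_part blk i (g (x + h)) - block_part blk i (g x)) \<le> L i * norm h)"

definition quadratic_growth :: "('a::euclidean_space \<Rightarrow> ereal) \<Rightarrow> real \<Rightarrow> bool" where
  "quadratic_growth F \<mu> \<longleftrightarrow>
     (\<forall>x. F x - min_value F \<ge> ereal (\<mu> / 2 * (norm (x - closest_point (minimizers F) x))\<^sup>2))"

text \<open>In the following, \<open>g\<close> is the gradient of \<open>f\<close>, \<open>H\<close> the matrix and \<open>d\<close> a direction of block \<open>i\<close>.\<close>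

definition block_model ::
  "('n::finite \<Rightarrow> 'b) \<Rightarrow> (real^'n \<Rightarrow> real^'n) \<Rightarrow> ('b \<Rightarrow> real^'n \<Rightarrow> ereal) \<Rightarrow>
   real^'n \<Rightarrow> 'b \<Rightarrow> real^'n^'n \<Rightarrow> real^'n \<Rightarrow> ereal" where
  "block_model blk g \<psi> x i H d =
     ereal (block_part blk i (g x) \<bullet> d + 1 / 2 * (d \<bullet> (H *v d)))
       + \<psi> i (block_part blk i x + d) - \<psi> i (block_part blk i x)"

definition approx_minimizer ::
  "('n::finite \<Rightarrow> 'b) \<Rightarrow> (real^'n \<Rightarrow> real^'n) \<Rightarrow> ('b \<Rightarrow> real^'n \<Rightarrow> ereal) \<Rightarrow>
   real \<Rightarrow> real^'n \<Rightarrow> 'b \<Rightarrow> real^'n^'n \<Rightarrow> real^'n \<Rightarrow> bool" where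
  "approx_minimizer blk g \<psi> \<eta> x i H d \<longleftrightarrow>
     (let Q = block_model blk g \<psi> x i H; Qmin = (INF e\<in>block_space blk i. Q e)
      in d \<in> block_space blk i \<and> ereal \<eta> * (Q 0 - Qmin) \<ge> Q d - Qmin)"

definition block_decrease ::
  "('n::finite \<Rightarrow> 'b) \<Rightarrow> (real^'n \<Rightarrow> real^'n) \<Rightarrow> ('b \<Rightarrow> real^'n \<Rightarrow> ereal) \<Rightarrow>
   real^'n \<Rightarrow> 'b \<Rightarrow> real^'n \<Rightarrow> ereal" where
  "block_decrease blk g \<psi> x i d =
     ereal (block_part blk i (g x) \<bullet> d)
       + \<psi> i (block_part blk i x + d) - \<psi> i (block_part blk i x)"

definition backtracking_step ::
  "('n::finite \<Rightarrow> 'b::finite) \<Rightarrow> (real^'n \<Rightarrow> real) \<Rightarrow> (real^'n \<Rightarrow> real^'n) \<Rightarrow>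
   ('b \<Rightarrow> real^'n \<Rightarrow> ereal) \<Rightarrow> real \<Rightarrow> real \<Rightarrow> real^'n \<Rightarrow> 'b \<Rightarrow> real^'n \<Rightarrow> real \<Rightarrow> bool" where
  "backtracking_step blk f g \<psi> \<beta> \<gamma> x i d \<alpha> \<longleftrightarrow>
     (let F = objective blk f \<psi>;
          S = {a \<in> range (\<lambda>j. \<beta> ^ j).
                 F (x + a *\<^sub>R d) \<le> F x + ereal (a * \<gamma>) * block_decrease blk g \<psi> x i d}
      in \<alpha> \<in> S \<and> (\<forall>a\<in>S. a \<le> \<alpha>))"

definition bcd_update :: "real^'n \<Rightarrow> ('b \<Rightarrow> real) \<Rightarrow> ('b \<Rightarrow> real^'n) \<Rightarrow> 'b \<Rightarrow> real^'n" where
  "bcd_update x \<alpha> d i = x + \<alpha> i *\<^sub>R d i"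

text \<open>
  A sample path of the randomized method: \<open>s t\<close> is the block sampled at iteration \<open>t\<close> and \<open>p t\<close> the
  distribution it is sampled from.  \<open>H t i\<close>, \<open>d t i\<close>, \<open>\<alpha> t i\<close> are defined for every block \<open>i\<close>, as
  the quantities that would result if \<open>i\<close> were sampled at iteration \<open>t\<close>.
\<close>

definition bcd_run ::
  "('n::finite \<Rightarrow> 'b::finite) \<Rightarrow> (real^'n \<Rightarrow> real) \<Rightarrow> (real^'n \<Rightarrow> real^'n) \<Rightarrow>
   ('b \<Rightarrow> real^'n \<Rightarrow> ereal) \<Rightarrow> real \<Rightarrow> real \<Rightarrow> real \<Rightarrow>
   (nat \<Rightarrow> real^'n) \<Rightarrow> (nat \<Rightarrow> 'b pmf) \<Rightarrow> (nat \<Rightarrow> 'b) \<Rightarrow>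
   (nat \<Rightarrow> 'b \<Rightarrow> real^'n^'n) \<Rightarrow> (nat \<Rightarrow> 'b \<Rightarrow> real^'n) \<Rightarrow> (nat \<Rightarrow> 'b \<Rightarrow> real) \<Rightarrow> bool" where
  "bcd_run blk f g \<psi> \<beta> \<gamma> \<eta> x p s H d \<alpha> \<longleftrightarrow>
     objective blk f \<psi> (x 0) < \<infinity> \<and>
     (\<forall>t. (\<forall>i. pmf (p t) i > 0 \<and>
               block_matrix blk i (H t i) \<and> transpose (H t i) = H t i \<and>
               block_posdef blk i (H t i) \<and>
               approx_minimizer blk g \<psi> \<eta> (x t) i (H t i) (d t i) \<and>
               backtracking_step blk f g \<psi> \<beta> \<gamma> (x t) i (d t i) (\<alpha> t i)) \<and>
          x (Suc t) = bcd_update (x t) (\<alpha> t) (d t) (s t))"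

text \<open>
  Expectation of an extended-valued random variable under \<open>p\<close>.  Negative values are truncated
  to 0 by \<^const>\<open>e2ennreal\<close>; it is only applied to the gap to the minimum value, which is nonnegative.
\<close>

definition nonneg_expectation :: "'b pmf \<Rightarrow> ('b \<Rightarrow> ereal) \<Rightarrow> ereal" where
  "nonneg_expectation p X = enn2ereal (\<integral>\<^sup>+ i. e2ennreal (X i) \<partial>measure_pmf p)"

end

theory Submission
  imports Defs
begin

text \<open>
  Let \<open>\<delta> = F(x) - F\<^sup>*\<close> be the current gap, \<open>y\<close> the projection of \<open>x\<close> onto the set of minimizers,
  \<open>w\<^sub>i = \<alpha>\<^sub>i p\<^sub>i\<close>, and \<open>K\<close> the spectral norm in the rate. If block \<open>i\<close> is sampled, the line search
  guarantees the decrease \<open>\<gamma> \<alpha>\<^sub>i \<Delta>\<^sub>i\<close>, and inexact minimality gives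
  \<open>\<Delta>\<^sub>i \<le> Q\<^sub>i(d\<^sub>i) \<le> (1 - \<eta>) Q\<^sub>i(e\<^sub>i)\<close> for every competing direction \<open>e\<^sub>i\<close>. Hence the expected gap is at
  most \<open>\<delta> + (1 - \<eta>) \<gamma> \<Sum>\<^sub>i w\<^sub>i Q\<^sub>i(e\<^sub>i)\<close>.

  The competitors are scaled against the weights: \<open>e\<^sub>i = (\<tau> / w\<^sub>i) (y - x)\<^sub>i\<close> with
  \<open>0 \<le> \<tau> \<le> \<pi> = min\<^sub>i w\<^sub>i\<close>. Then the first-order parts sum up, by convexity, to at most \<open>- \<tau> \<delta>\<close>, and the
  quadratic parts to at most \<open>\<tau>\<^sup>2 / 2\<close> times \<open>K \<parallel>y - x\<parallel>\<^sup>2\<close>, which quadratic growth bounds by \<open>2 K \<delta> / \<mu>\<close>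
  (\<open>weighted_model_le\<close>, \<open>weighted_block_form_le\<close>). This gives the rate \<open>\<rho> = \<tau> - \<tau>\<^sup>2 K / \<mu>\<close> for every
  \<open>\<tau> \<in> [0, \<pi>]\<close> (\<open>expected_gap_le\<close>). Its maximum over \<open>\<tau> \<ge> 0\<close> is at \<open>\<mu> / (2 K)\<close> with value \<open>\<mu> / (4 K)\<close>;
  if that point exceeds \<open>\<pi>\<close>, then \<open>\<tau> = \<pi>\<close> is the best choice. These are the two cases of the theorem.

  The step sizes are bounded away from 0 because the descent lemma makes the line search accept every
  trial step up to \<open>(1 - \<gamma>) m\<^sub>i / L\<^sub>i\<close> (\<open>backtracking_step_bound\<close>), a threshold independent of the
  iterate.

  Two facts support this argument: the subproblem values \<open>Q\<^sub>i\<^sup>*\<close> are finite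
  (\<open>real_decrease_lower_bound\<close>), and the set of minimizers is closed, so that \<open>y\<close> belongs to it
  (\<open>closed_minimizers\<close>).
\<close>

section \<open>Orthogonal decomposition into blocks\<close>

lemma block_part_nth [simp]: "block_part blk i x $ j = (if blk j = i then x $ j else 0)"
  by (simp add: block_part_def)

lemma block_part_mem [simp, intro]: "block_part blk i x \<in> block_space blk i"
  by (simp add: block_space_def)

lemma subspace_block_space: "subspace (block_space blk i)"
  by (auto simp: subspace_def block_space_def)

lemma closed_block_space: "closed (block_space blk i)"
  by (rule closed_subspace[OF subspace_block_space])

lemma linear_block_part: "linear (block_part blk i)"
  by (rule linearI) (auto simp: vec_eq_iff)

lemmas block_part_add = linear_add[OF linear_block_part]
  and block_part_diff = linear_diff[OF linear_block_part]
  and block_part_scaleR = linear_scale[OF linear_block_part]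

lemma block_part_same: "d \<in> block_space blk i \<Longrightarrow> block_part blk i d = d"
  by (auto simp: vec_eq_iff block_space_def)

lemma block_part_other: "d \<in> block_space blk i \<Longrightarrow> j \<noteq> i \<Longrightarrow> block_part blk j d = 0"
  by (auto simp: vec_eq_iff block_space_def)

lemma sum_block_part: "(\<Sum>i\<in>UNIV. block_part blk i x) = (x :: real^'n)"
  for blk :: "'n::finite \<Rightarrow> 'b::finite"
  by (simp add: vec_eq_iff)

lemma inner_block_part: "block_part blk i x \<bullet> d = x \<bullet> d" if "d \<in> block_space blk i"
  using that unfolding inner_vec_def by (intro sum.cong) (auto simp: block_space_def)

lemma inner_block_sum: "x \<bullet> y = (\<Sum>i\<in>UNIV. block_part blk i x \<bullet> block_part blk i y)"
  for blk :: "'n::finite \<Rightarrow> 'b::finite"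
proof -
  have "x \<bullet> y = x \<bullet> (\<Sum>i\<in>UNIV. block_part blk i y)"
    by (simp add: sum_block_part)
  also have "\<dots> = (\<Sum>i\<in>UNIV. x \<bullet> block_part blk i y)"
    by (simp add: inner_sum_right)
  finally show ?thesis
    by (simp add: inner_block_part)
qed

text \<open>
  Compactness of the unit sphere of the block space. It covers the iterations for which only positive
  definiteness of the matrices is known.
\<close>

lemma block_posdef_coercive:
  assumes "block_posdef blk i M"
  shows "\<exists>m>0. \<forall>d\<in>block_space blk i. m * (norm d)\<^sup>2 \<le> d \<bullet> (M *v d)"
proof (cases "block_space blk i \<inter> sphere 0 1 = {}")
  case True
  have "d = 0" if "d \<in> block_space blk i" for d
  proof (rule ccontr)
    assume "d \<noteq> 0"
    then have "(1 / norm d) *\<^sub>R d \<in> block_space blk i \<inter> sphere 0 1"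
      using that subspace_scale[OF subspace_block_space] by auto
    with True show False by blast
  qed
  then show ?thesis by (intro exI[of _ 1]) force
next
  case False
  have "compact (block_space blk i \<inter> sphere 0 1)"
    by (simp add: closed_Int_compact closed_block_space)
  moreover have "continuous_on (block_space blk i \<inter> sphere 0 1) (\<lambda>d. d \<bullet> (M *v d))"
    by (intro continuous_intros linear_continuous_on) (auto simp: linear_linear)
  ultimately obtain u where u: "u \<in> block_space blk i \<inter> sphere 0 1"
    and min: "\<forall>d\<in>block_space blk i \<inter> sphere 0 1. u \<bullet> (M *v u) \<le> d \<bullet> (M *v d)"
    using continuous_attains_inf[OF _ False] by blast
  let ?m = "u \<bullet> (M *v u)"
  have "?m > 0"
    using assms u unfolding block_posdef_def by (force simp: block_space_def)
  moreover have "?m * (norm d)\<^sup>2 \<le> d \<bullet> (M *v d)" if "d \<in> block_space blk i" for d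
  proof (cases "d = 0")
    case False
    let ?e = "(1 / norm d) *\<^sub>R d"
    have "?e \<in> block_space blk i \<inter> sphere 0 1"
      using that False subspace_scale[OF subspace_block_space] by auto
    then have "?m \<le> ?e \<bullet> (M *v ?e)"
      using min by blast
    also have "\<dots> = (d \<bullet> (M *v d)) / (norm d)\<^sup>2"
      by (simp add: matrix_vector_mult_scaleR power2_eq_square)
    finally show ?thesis
      using False by (simp add: field_simps)
  qed simp
  ultimately show ?thesis by blast
qed

lemma block_psd_shift_coercive:
  assumes "block_psd blk i (M - m *\<^sub>R mat 1)" "d \<in> block_space blk i"
  shows "m * (norm d)\<^sup>2 \<le> d \<bullet> (M *v d)"
  using assms unfolding block_psd_def
  by (auto simp: matrix_vector_mult_diff_rdistrib inner_diff_right power2_norm_eq_inner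
      simp flip: scaleR_matrix_vector_assoc)

lemma block_diag_mult:
  fixes blk :: "'n::finite \<Rightarrow> 'b::finite"
  shows "block_part blk i (block_diag blk B *v x) = block_part blk i (B i *v block_part blk i x)"
  by (auto simp: vec_eq_iff block_diag_def matrix_vector_mult_def intro!: sum.cong)

lemma matrix_inv_block_diag_scalar:
  fixes blk :: "'n::finite \<Rightarrow> 'b::finite"
  assumes "\<And>i. c i \<noteq> 0"
  shows "matrix_inv (block_diag blk (\<lambda>i. c i *\<^sub>R mat 1)) = block_diag blk (\<lambda>i. (1 / c i) *\<^sub>R mat 1)"
    (is "matrix_inv ?D = ?E")
proof -
  have entry: "block_diag blk (\<lambda>i. a i *\<^sub>R mat 1) $ r $ s = (if r = s then a (blk r) else 0)" for a r s
    by (simp add: block_diag_def mat_def)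
  have inverse: "?D ** ?E = mat 1"
    unfolding vec_eq_iff matrix_matrix_mult_def vec_lambda_beta entry
    using assms by (auto simp: mat_def if_distrib[of "\<lambda>u. u * _"] if_distrib[of "\<lambda>u. _ * u"] cong: if_cong)
  then have "?E ** ?D = mat 1"
    by (simp add: matrix_left_right_inverse)
  with inverse have "invertible ?D"
    unfolding invertible_def by blast
  then have "?D ** matrix_inv ?D = mat 1 \<and> matrix_inv ?D ** ?D = mat 1"
    unfolding invertible_def matrix_inv_def by (rule someI_ex)
  then have "matrix_inv ?D = matrix_inv ?D ** (?D ** ?E)"
    by (simp add: inverse)
  also have "\<dots> = ?E"
    using \<open>_ \<and> matrix_inv ?D ** ?D = mat 1\<close> by (simp add: matrix_mul_assoc)
  finally show ?thesis .
qed

text \<open>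
  The quadratic form of \<open>P\<^sup>-\<^sup>1 A\<^sup>-\<^sup>1 H\<close> splits over the blocks because \<open>P\<close> and \<open>A\<close> are scalar on each
  block, and Cauchy-Schwarz bounds it by the operator norm.
\<close>

lemma weighted_block_form_le:
  fixes blk :: "'n::finite \<Rightarrow> 'b::finite" and z :: "real^'n"
  assumes "\<And>i. a i \<noteq> 0" "\<And>i. b i \<noteq> 0"
  shows "(\<Sum>i\<in>UNIV. 1 / (b i * a i) * (block_part blk i z \<bullet> (H i *v block_part blk i z)))
    \<le> spectral_norm (matrix_inv (block_diag blk (\<lambda>i. a i *\<^sub>R mat 1))
         ** matrix_inv (block_diag blk (\<lambda>i. b i *\<^sub>R mat 1)) ** block_diag blk H) * (norm z)\<^sup>2"
    (is "?S \<le> spectral_norm ?M * _")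
proof -
  have "block_part blk i (?M *v z)
      = (1 / (b i * a i)) *\<^sub>R block_part blk i (H i *v block_part blk i z)" for i
    unfolding matrix_inv_block_diag_scalar[of a, OF assms(1)] matrix_inv_block_diag_scalar[of b, OF assms(2)]
      matrix_vector_mul_assoc[symmetric] block_diag_mult scaleR_matrix_vector_assoc[symmetric]
      matrix_vector_mul_lid block_part_scaleR
    by (simp add: block_part_same)
  then have "z \<bullet> (?M *v z) = ?S"
    unfolding inner_block_sum[of z "?M *v z" blk]
    by (simp add: inner_block_part inner_commute[of "block_part blk _ z"])
  then have "?S \<le> norm z * norm (?M *v z)"
    using norm_cauchy_schwarz[of z "?M *v z"] by linarith
  also have "\<dots> \<le> norm z * (spectral_norm ?M * norm z)"
    unfolding spectral_norm_def by (intro mult_left_mono onorm) auto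
  finally show ?thesis
    by (simp add: power2_eq_square mult_ac)
qed

section \<open>Extended-valued convex functions\<close>

lemma ext_convexD:
  assumes "convex (ext_epigraph S \<phi>)" "u \<in> S" "v \<in> S" "\<phi> u \<le> ereal a" "\<phi> v \<le> ereal b"
    "0 \<le> t" "t \<le> 1"
  shows "\<phi> ((1 - t) *\<^sub>R u + t *\<^sub>R v) \<le> ereal ((1 - t) * a + t * b)"
proof -
  have "(1 - t) *\<^sub>R (u, a) + t *\<^sub>R (v, b) \<in> ext_epigraph S \<phi>"
    by (rule convexD_alt[OF assms(1)]) (use assms in \<open>auto simp: ext_epigraph_def\<close>)
  then show ?thesis by (simp add: ext_epigraph_def)
qed

text \<open>
  Sequential lower semicontinuity: if the values fell below some \<open>r < \<phi> v\<close> infinitely often, the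
  points \<open>(u n, r)\<close> would lie in the epigraph infinitely often, and so would their limit \<open>(v, r)\<close>.
\<close>

lemma ext_closed_liminf:
  assumes closed: "closed (ext_epigraph S \<phi>)" and u: "\<And>n. u n \<in> S" "u \<longlonglongrightarrow> v"
  shows "\<phi> v \<le> liminf (\<lambda>n. \<phi> (u n))"
proof (rule ccontr)
  assume "\<not> ?thesis"
  then have "liminf (\<lambda>n. \<phi> (u n)) < \<phi> v"
    by (simp add: not_le)
  then obtain r where r: "liminf (\<lambda>n. \<phi> (u n)) < ereal r" "ereal r < \<phi> v"
    using ereal_dense2 by meson
  have "frequently (\<lambda>n. \<phi> (u n) \<le> ereal r) sequentially"
  proof (rule ccontr)
    assume "\<not> ?thesis"
    then have "eventually (\<lambda>n. \<not> \<phi> (u n) \<le> ereal r) sequentially"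
      by (simp add: not_frequently)
    then have "eventually (\<lambda>n. ereal r \<le> \<phi> (u n)) sequentially"
      by (rule eventually_mono) simp
    then have "ereal r \<le> liminf (\<lambda>n. \<phi> (u n))"
      by (rule Liminf_bounded)
    with r show False by simp
  qed
  then have freq: "frequently (\<lambda>n. (u n, r) \<in> ext_epigraph S \<phi>) sequentially"
    by (rule frequently_elim1) (use u in \<open>auto simp: ext_epigraph_def\<close>)
  have lim: "((\<lambda>n. (u n, r)) \<longlongrightarrow> (v, r)) sequentially"
    by (intro tendsto_intros u)
  have "(v, r) \<in> ext_epigraph S \<phi>"
  proof (rule ccontr)
    assume "(v, r) \<notin> ext_epigraph S \<phi>"
    then have "eventually (\<lambda>n. (u n, r) \<in> - ext_epigraph S \<phi>) sequentially"
      by (intro topological_tendstoD[OF lim] open_Compl[OF closed]) simp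
    with freq show False
      by (simp add: frequently_def)
  qed
  with r show False by (auto simp: ext_epigraph_def)
qed

lemma sum_le_liminf_sum:
  fixes a :: "'i \<Rightarrow> ereal" and X :: "'i \<Rightarrow> nat \<Rightarrow> ereal"
  assumes "finite I" "\<And>i. i \<in> I \<Longrightarrow> a i \<noteq> -\<infinity>" "\<And>i. i \<in> I \<Longrightarrow> a i \<le> liminf (X i)"
  shows "(\<Sum>i\<in>I. a i) \<noteq> -\<infinity> \<and> (\<Sum>i\<in>I. a i) \<le> liminf (\<lambda>n. \<Sum>i\<in>I. X i n)"
  using assms
proof (induction I rule: finite_induct)
  case empty
  then show ?case by (simp add: Liminf_const)
next
  case (insert j I)
  let ?s = "\<Sum>i\<in>I. a i" and ?T = "\<lambda>n. \<Sum>i\<in>I. X i n"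
  have IH: "?s \<noteq> -\<infinity>" "?s \<le> liminf ?T"
    using insert by auto
  have j: "a j \<noteq> -\<infinity>" "a j \<le> liminf (X j)"
    using insert by auto
  have "a j + ?s \<le> liminf (X j) + liminf ?T"
    using IH j by (intro add_mono)
  also have "\<dots> \<le> liminf (\<lambda>n. X j n + ?T n)"
    using IH j by (intro ereal_liminf_add_mono) auto
  finally show ?case
    using insert IH j by (simp add: ereal_plus_eq_MInfty)
qed

section \<open>Composite functions with blockwise Lipschitz gradient\<close>

locale composite_problem =
  fixes blk :: "'n::finite \<Rightarrow> 'b::finite"
    and f :: "real^'n \<Rightarrow> real" and g :: "real^'n \<Rightarrow> real^'n"
    and \<psi> :: "'b \<Rightarrow> real^'n \<Rightarrow> ereal" and L :: "'b \<Rightarrow> real"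
  assumes gradient: "\<And>y. GDERIV f y :> g y"
    and f_convex: "convex_on UNIV f"
    and L_pos: "\<And>i. L i > 0"
    and lipschitz: "blockwise_lipschitz blk g L"
    and psi: "\<And>i. closed_convex_proper_on (block_space blk i) (\<psi> i)"
    and minimizers_nonempty: "minimizers (objective blk f \<psi>) \<noteq> {}"
begin

text \<open>
  All estimates take place at points where \<open>F\<close> is finite; there the extended-valued quantities are
  replaced by the following real ones.
\<close>

definition feasible :: "real^'n \<Rightarrow> bool" where
  "feasible x \<longleftrightarrow> (\<forall>i. \<psi> i (block_part blk i x) < \<infinity>)"

definition real_psi :: "'b \<Rightarrow> real^'n \<Rightarrow> real" where
  "real_psi i v = real_of_ereal (\<psi> i v)"

definition real_objective :: "real^'n \<Rightarrow> real" where
  "real_objective x = f x + (\<Sum>i\<in>UNIV. real_psi i (block_part blk i x))"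

definition real_decrease :: "real^'n \<Rightarrow> 'b \<Rightarrow> real^'n \<Rightarrow> real" where
  "real_decrease x i d = block_part blk i (g x) \<bullet> d
     + (real_psi i (block_part blk i x + d) - real_psi i (block_part blk i x))"

definition feasible_dirs :: "real^'n \<Rightarrow> 'b \<Rightarrow> (real^'n) set" where
  "feasible_dirs x i = {d \<in> block_space blk i. \<psi> i (block_part blk i x + d) < \<infinity>}"

lemma psi_not_MInfty: "v \<in> block_space blk i \<Longrightarrow> \<psi> i v \<noteq> -\<infinity>"
  using psi[of i] by (auto simp: closed_convex_proper_on_def proper_on_def)

lemma psi_real: "v \<in> block_space blk i \<Longrightarrow> \<psi> i v < \<infinity> \<Longrightarrow> \<psi> i v = ereal (real_psi i v)"
  using psi_not_MInfty[of v i] unfolding real_psi_def by (cases "\<psi> i v") auto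

lemma feasibleD: "feasible x \<Longrightarrow> \<psi> i (block_part blk i x) = ereal (real_psi i (block_part blk i x))"
  by (simp add: psi_real feasible_def)

lemma shift_mem: "d \<in> block_space blk i \<Longrightarrow> block_part blk i x + d \<in> block_space blk i"
  by (simp add: subspace_add[OF subspace_block_space])

lemma feasible_dirsD:
  assumes "d \<in> feasible_dirs x i"
  shows "d \<in> block_space blk i"
    "\<psi> i (block_part blk i x + d) = ereal (real_psi i (block_part blk i x + d))"
  using assms by (auto simp: feasible_dirs_def intro!: psi_real shift_mem)

lemma zero_feasible_dir: "feasible x \<Longrightarrow> 0 \<in> feasible_dirs x i"
  by (simp add: feasible_dirs_def feasible_def subspace_0[OF subspace_block_space])

lemma real_decrease_zero: "real_decrease x i 0 = 0"
  by (simp add: real_decrease_def)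

lemma objective_finite_iff: "objective blk f \<psi> x < \<infinity> \<longleftrightarrow> feasible x"
proof -
  have "objective blk f \<psi> x = \<infinity> \<longleftrightarrow> (\<exists>i. \<psi> i (block_part blk i x) = \<infinity>)"
    by (simp add: objective_def sum_Pinfty)
  then show ?thesis
    by (simp add: feasible_def less_top[symmetric] top_ereal_def)
qed

lemma objective_real: "feasible x \<Longrightarrow> objective blk f \<psi> x = ereal (real_objective x)"
  by (simp add: objective_def real_objective_def feasibleD)

lemma feasible_minimizer:
  assumes "feasible x" "y \<in> minimizers (objective blk f \<psi>)"
  shows "feasible y" "min_value (objective blk f \<psi>) = ereal (real_objective y)"
    "real_objective y \<le> real_objective x"
proof -
  have le: "objective blk f \<psi> y \<le> objective blk f \<psi> z" for z
    using assms by (simp add: minimizers_def)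
  from le[of x] show y: "feasible y"
    using assms(1) by (metis objective_finite_iff order_le_less_trans)
  have "min_value (objective blk f \<psi>) = objective blk f \<psi> y"
    unfolding min_value_def by (intro antisym INF_lower INF_greatest le) auto
  then show "min_value (objective blk f \<psi>) = ereal (real_objective y)"
    by (simp add: objective_real y)
  show "real_objective y \<le> real_objective x"
    using le[of x] assms y by (simp add: objective_real)
qed

lemma block_step:
  assumes "feasible x" "d \<in> feasible_dirs x i"
  shows "feasible (x + d)"
    "real_objective (x + d) = real_objective x + (f (x + d) - f x)
       + (real_psi i (block_part blk i x + d) - real_psi i (block_part blk i x))"
proof -
  note d = feasible_dirsD(1)[OF assms(2)]
  have part: "block_part blk j (x + d) = (if j = i then block_part blk i x + d else block_part blk j x)" for j
    using d by (simp add: block_part_add block_part_same block_part_other)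
  show "feasible (x + d)"
    using assms by (simp add: feasible_def part feasible_dirs_def)
  have "(\<Sum>j\<in>UNIV. real_psi j (block_part blk j (x + d)) - real_psi j (block_part blk j x))
      = (\<Sum>j\<in>UNIV. if j = i then real_psi i (block_part blk i x + d) - real_psi i (block_part blk i x) else 0)"
    by (intro sum.cong) (auto simp: part)
  then show "real_objective (x + d) = real_objective x + (f (x + d) - f x)
      + (real_psi i (block_part blk i x + d) - real_psi i (block_part blk i x))"
    by (simp add: real_objective_def sum_subtractf)
qed

lemma real_psi_convex:
  assumes "u \<in> block_space blk i" "v \<in> block_space blk i" "\<psi> i u < \<infinity>" "\<psi> i v < \<infinity>" "0 \<le> t" "t \<le> 1"
  shows "\<psi> i ((1 - t) *\<^sub>R u + t *\<^sub>R v) < \<infinity>"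
    "real_psi i ((1 - t) *\<^sub>R u + t *\<^sub>R v) \<le> (1 - t) * real_psi i u + t * real_psi i v"
proof -
  let ?w = "(1 - t) *\<^sub>R u + t *\<^sub>R v"
  have le: "\<psi> i ?w \<le> ereal ((1 - t) * real_psi i u + t * real_psi i v)"
    by (rule ext_convexD[where S = "block_space blk i"])
      (use assms psi[of i] in \<open>auto simp: psi_real closed_convex_proper_on_def\<close>)
  then show fin: "\<psi> i ?w < \<infinity>"
    by (rule order_le_less_trans) simp
  have "?w \<in> block_space blk i"
    by (intro subspace_add subspace_scale subspace_block_space assms)
  then show "real_psi i ?w \<le> (1 - t) * real_psi i u + t * real_psi i v"
    using le fin by (simp add: psi_real)
qed

text \<open>
  Convexity of \<open>\<psi>\<^sub>i\<close> makes the predicted decrease subhomogeneous on \<open>[0, 1]\<close>. Both the line search and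
  the comparison with the shrunken directions towards a minimizer depend on it.
\<close>

lemma real_decrease_scale:
  assumes "feasible x" "d \<in> feasible_dirs x i" "0 \<le> t" "t \<le> 1"
  shows "t *\<^sub>R d \<in> feasible_dirs x i" "real_decrease x i (t *\<^sub>R d) \<le> t * real_decrease x i d"
proof -
  note d = feasible_dirsD[OF assms(2)]
  have eq: "(1 - t) *\<^sub>R block_part blk i x + t *\<^sub>R (block_part blk i x + d) = block_part blk i x + t *\<^sub>R d"
    by (simp add: algebra_simps)
  note conv = real_psi_convex[of "block_part blk i x" i "block_part blk i x + d" t, unfolded eq]
  have hyp: "block_part blk i x \<in> block_space blk i" "block_part blk i x + d \<in> block_space blk i"
    "\<psi> i (block_part blk i x) < \<infinity>" "\<psi> i (block_part blk i x + d) < \<infinity>"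
    using d shift_mem assms by (auto simp: feasible_def)
  show "t *\<^sub>R d \<in> feasible_dirs x i"
    using conv(1)[OF hyp assms(3,4)] d by (simp add: feasible_dirs_def subspace_scale[OF subspace_block_space])
  show "real_decrease x i (t *\<^sub>R d) \<le> t * real_decrease x i d"
    using conv(2)[OF hyp assms(3,4)] by (simp add: real_decrease_def algebra_simps)
qed

lemma line_derivative:
  "((\<lambda>t. f (x + t *\<^sub>R d)) has_real_derivative g (x + t *\<^sub>R d) \<bullet> d) (at t)"
proof -
  have "((\<lambda>t. f (x + t *\<^sub>R d)) has_derivative (\<lambda>h. (h *\<^sub>R d) \<bullet> g (x + t *\<^sub>R d))) (at t)"
    by (rule has_derivative_compose[where g = f])
      (auto intro!: derivative_eq_intros gradient[unfolded gderiv_def])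
  then show ?thesis
    by (simp add: has_field_derivative_def inner_commute mult_commute_abs)
qed

lemma gradient_inequality: "f x + g x \<bullet> (y - x) \<le> f y"
proof -
  let ?h = "\<lambda>t. f (x + t *\<^sub>R (y - x))"
  have "convex_on UNIV ?h"
  proof (rule convex_onI)
    fix s a b :: real assume s: "0 < s" "s < 1"
    have "x + ((1 - s) *\<^sub>R a + s *\<^sub>R b) *\<^sub>R (y - x)
        = (1 - s) *\<^sub>R (x + a *\<^sub>R (y - x)) + s *\<^sub>R (x + b *\<^sub>R (y - x))"
      by (simp add: algebra_simps)
    then show "?h ((1 - s) *\<^sub>R a + s *\<^sub>R b) \<le> (1 - s) * ?h a + s * ?h b"
      using convex_onD[OF f_convex, of s "x + a *\<^sub>R (y - x)" "x + b *\<^sub>R (y - x)"] s by simp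
  qed simp
  moreover have "(?h has_real_derivative g x \<bullet> (y - x)) (at 0)"
    using line_derivative[of x "y - x" 0] by simp
  ultimately have "?h 1 - ?h 0 \<ge> (g x \<bullet> (y - x)) * (1 - 0)"
    by (intro convex_on_imp_above_tangent[of UNIV]) auto
  then show ?thesis by simp
qed

text \<open>
  The Lipschitz condition controls the derivative of \<open>f\<close> along a block direction, so \<open>f\<close> minus its
  quadratic model is nonincreasing along the segment from \<open>x\<close> to \<open>x + d\<close>.
\<close>

lemma block_descent:
  assumes d: "d \<in> block_space blk i"
  shows "f (x + d) \<le> f x + block_part blk i (g x) \<bullet> d + L i / 2 * (norm d)\<^sup>2"
proof -
  let ?h = "\<lambda>t. f (x + t *\<^sub>R d) - t * (g x \<bullet> d) - t\<^sup>2 * (L i / 2 * (norm d)\<^sup>2)"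
  have deriv: "(?h has_real_derivative
      g (x + t *\<^sub>R d) \<bullet> d - g x \<bullet> d - 2 * t * (L i / 2 * (norm d)\<^sup>2)) (at t)" for t
    by (rule derivative_eq_intros line_derivative refl | simp)+
  have nonpos: "g (x + t *\<^sub>R d) \<bullet> d - g x \<bullet> d - 2 * t * (L i / 2 * (norm d)\<^sup>2) \<le> 0" if "0 \<le> t" for t
  proof -
    let ?u = "block_part blk i (g (x + t *\<^sub>R d)) - block_part blk i (g x)"
    have "t *\<^sub>R d \<in> block_space blk i"
      by (intro subspace_scale subspace_block_space d)
    then have "norm ?u \<le> L i * norm (t *\<^sub>R d)"
      using lipschitz unfolding blockwise_lipschitz_def by blast
    then have "norm ?u * norm d \<le> (L i * (t * norm d)) * norm d"
      using that by (intro mult_right_mono) auto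
    moreover have "g (x + t *\<^sub>R d) \<bullet> d - g x \<bullet> d = ?u \<bullet> d"
      by (simp add: inner_diff_left inner_block_part d)
    ultimately show ?thesis
      using norm_cauchy_schwarz[of ?u d] by (simp add: power2_eq_square mult_ac)
  qed
  have "?h 1 \<le> ?h 0"
    by (rule DERIV_nonpos_imp_nonincreasing[where f = ?h]) (use deriv nonpos in fastforce)+
  then show ?thesis
    by (simp add: inner_block_part d)
qed

lemma real_objective_step_le:
  assumes "feasible x" "d \<in> feasible_dirs x i" "0 \<le> t" "t \<le> 1"
  shows "real_objective (x + t *\<^sub>R d)
    \<le> real_objective x + t * real_decrease x i d + t\<^sup>2 * (L i / 2 * (norm d)\<^sup>2)"
proof -
  note td = real_decrease_scale[OF assms]
  have "real_objective (x + t *\<^sub>R d)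
      \<le> real_objective x + real_decrease x i (t *\<^sub>R d) + L i / 2 * (norm (t *\<^sub>R d))\<^sup>2"
    using block_step(2)[OF assms(1) td(1)] block_descent[OF feasible_dirsD(1)[OF td(1)], of x]
    by (simp add: real_decrease_def)
  with td(2) show ?thesis
    by (simp add: power_mult_distrib mult_ac)
qed

text \<open>
  On the unit ball the bound holds because \<open>F\<close> is bounded below by its minimum and \<open>f\<close> has a quadratic
  upper model; convexity extends it linearly to all directions. A subproblem with a coercive
  quadratic term is therefore bounded below. If \<open>Q\<^sup>* = -\<infinity>\<close> were possible,
  approximate minimality with \<open>\<eta> > 0\<close> would hold for every direction.
\<close>

lemma real_decrease_lower_bound:
  assumes "feasible x"
  shows "\<exists>C\<ge>0. \<forall>d\<in>feasible_dirs x i. - C * (1 + norm d) \<le> real_decrease x i d"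
proof -
  obtain y where y: "y \<in> minimizers (objective blk f \<psi>)"
    using minimizers_nonempty by blast
  define C where "C = real_objective x - real_objective y + L i / 2"
  have C: "C \<ge> 0"
    unfolding C_def using feasible_minimizer(3)[OF assms y] L_pos[of i] by simp
  have unit: "- C \<le> real_decrease x i d" if d: "d \<in> feasible_dirs x i" "norm d \<le> 1" for d
  proof -
    have "real_objective y \<le> real_objective (x + d)"
      using block_step(1)[OF assms d(1)] y feasible_minimizer(3) by blast
    moreover have "(norm d)\<^sup>2 \<le> 1"
      using d(2) by (simp add: power_le_one)
    then have "L i / 2 * (norm d)\<^sup>2 \<le> L i / 2"
      using L_pos[of i] by simp
    ultimately show ?thesis
      using real_objective_step_le[OF assms d(1), of 1] by (simp add: C_def)
  qed
  have "- C * (1 + norm d) \<le> real_decrease x i d" if d: "d \<in> feasible_dirs x i" for d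
  proof (cases "norm d \<le> 1")
    case True
    have "C * 1 \<le> C * (1 + norm d)"
      by (rule mult_left_mono) (use C in auto)
    then show ?thesis using unit[OF d True] by simp
  next
    case False
    let ?t = "1 / norm d"
    have t: "0 \<le> ?t" "?t \<le> 1" using False by (auto simp: divide_le_eq_1)
    have n: "norm (?t *\<^sub>R d) \<le> 1" using False by auto
    have "- C \<le> ?t * real_decrease x i d"
      using unit[OF real_decrease_scale(1)[OF assms d t] n] real_decrease_scale(2)[OF assms d t]
      by simp
    moreover have "0 < norm d"
      using False by linarith
    ultimately have "- C * norm d \<le> real_decrease x i d"
      by (simp add: pos_le_divide_eq)
    moreover have "C * (1 + norm d) = C + C * norm d"
      by (simp add: algebra_simps)
    ultimately show ?thesis
      using C by simp
  qed
  with C show ?thesis by blast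
qed

text \<open>
  Closedness guarantees that the Euclidean projection onto the set of minimizers is a minimizer.
  It follows from lower semicontinuity of \<open>F\<close>.
\<close>

lemma closed_minimizers:
  shows "closed (minimizers (objective blk f \<psi>))"
  unfolding closed_sequential_limits
proof (intro allI impI)
  fix u y assume uy: "(\<forall>n. u n \<in> minimizers (objective blk f \<psi>)) \<and> u \<longlonglongrightarrow> y"
  let ?F = "objective blk f \<psi>"
  obtain c where c: "\<And>n. ?F (u n) = c" "\<And>z. c \<le> ?F z"
    using uy unfolding minimizers_def by (metis (mono_tags, lifting) antisym mem_Collect_eq)
  have cont_f: "isCont f y"
    using gradient[of y] unfolding gderiv_def by (rule has_derivative_continuous)
  have cont_part: "(\<lambda>n. block_part blk i (u n)) \<longlonglongrightarrow> block_part blk i y" for i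
    using uy by (intro bounded_linear.tendsto[OF linear_block_part[unfolded linear_conv_bounded_linear]]) simp
  have sum: "(\<Sum>i\<in>UNIV. \<psi> i (block_part blk i y)) \<noteq> -\<infinity> \<and> (\<Sum>i\<in>UNIV. \<psi> i (block_part blk i y))
      \<le> liminf (\<lambda>n. \<Sum>i\<in>UNIV. \<psi> i (block_part blk i (u n)))"
    by (intro sum_le_liminf_sum ext_closed_liminf[OF _ _ cont_part])
      (use psi psi_not_MInfty in \<open>auto simp: closed_convex_proper_on_def\<close>)
  have "(\<lambda>n. ereal (f (u n))) \<longlonglongrightarrow> ereal (f y)"
    using isCont_tendsto_compose[OF cont_f, of u] uy by simp
  then have lim: "liminf (\<lambda>n. ereal (f (u n))) = ereal (f y)"
    by (intro lim_imp_Liminf) auto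
  have "?F y \<le> liminf (\<lambda>n. ereal (f (u n))) + liminf (\<lambda>n. \<Sum>i\<in>UNIV. \<psi> i (block_part blk i (u n)))"
    unfolding objective_def lim using sum by (intro add_mono) auto
  also have "\<dots> \<le> liminf (\<lambda>n. ?F (u n))"
    unfolding objective_def by (intro ereal_liminf_add_mono) (simp add: lim)
  also have "\<dots> = c"
    by (simp add: c Liminf_const)
  finally show "y \<in> minimizers ?F"
    using c(2) order_trans unfolding minimizers_def by blast
qed

section \<open>Inexact subproblem solutions and the line search\<close>

lemma block_decrease_real:
  assumes "feasible x" "d \<in> feasible_dirs x i"
  shows "block_decrease blk g \<psi> x i d = ereal (real_decrease x i d)"
  using assms by (simp add: block_decrease_def real_decrease_def feasibleD feasible_dirsD)

lemma block_model_real: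
  assumes "feasible x" "d \<in> feasible_dirs x i"
  shows "block_model blk g \<psi> x i M d = ereal (real_decrease x i d + 1 / 2 * (d \<bullet> (M *v d)))"
  using assms by (simp add: block_model_def real_decrease_def feasibleD feasible_dirsD)

lemma block_model_infinite:
  assumes "feasible x" "d \<in> block_space blk i" "d \<notin> feasible_dirs x i"
  shows "block_model blk g \<psi> x i M d = \<infinity>"
  using assms by (simp add: block_model_def feasibleD feasible_dirs_def)

text \<open>
  Since \<open>Q(0) = 0\<close>, approximate minimality reads \<open>Q(d) \<le> (1 - \<eta>) Q\<^sup>*\<close>, and \<open>Q\<^sup>*\<close> is at most the value at
  any competitor \<open>e\<close>.
\<close>

lemma approx_minimizer_le:
  assumes x: "feasible x" and \<eta>: "0 \<le> \<eta>" "\<eta> < 1" and m: "0 < m"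
    and M: "\<And>d. d \<in> block_space blk i \<Longrightarrow> m * (norm d)\<^sup>2 \<le> d \<bullet> (M *v d)"
    and approx: "approx_minimizer blk g \<psi> \<eta> x i M d"
  shows "d \<in> feasible_dirs x i"
    and "e \<in> feasible_dirs x i \<Longrightarrow> real_decrease x i d + 1 / 2 * (d \<bullet> (M *v d))
       \<le> (1 - \<eta>) * (real_decrease x i e + 1 / 2 * (e \<bullet> (M *v e)))"
proof -
  define Q where "Q = block_model blk g \<psi> x i M"
  define q where "q = (INF e\<in>block_space blk i. Q e)"
  have d: "d \<in> block_space blk i" and opt: "Q d - q \<le> ereal \<eta> * (Q 0 - q)"
    using approx by (simp_all add: approx_minimizer_def Let_def Q_def q_def)
  have Q0: "Q 0 = 0"
    using block_model_real[OF x zero_feasible_dir[OF x]]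
    by (simp add: Q_def real_decrease_zero)
  obtain C where C: "C \<ge> 0" "\<And>e. e \<in> feasible_dirs x i \<Longrightarrow> - C * (1 + norm e) \<le> real_decrease x i e"
    using real_decrease_lower_bound[OF x] by blast
  \<comment> \<open>minimum of the quadratic \<open>- C * (1 + r) + m / 2 * r\<^sup>2\<close> in \<open>r\<close>\<close>
  have "ereal (- C - C\<^sup>2 / (2 * m)) \<le> Q e" if e: "e \<in> block_space blk i" for e
  proof (cases "e \<in> feasible_dirs x i")
    case True
    have "0 \<le> m / 2 * (norm e - C / m)\<^sup>2"
      using m by simp
    also have "\<dots> = m / 2 * (norm e)\<^sup>2 - C * norm e + C\<^sup>2 / (2 * m)"
      using m by (simp add: power2_eq_square field_simps)
    finally show ?thesis
      using C(2)[OF True] M[OF e] by (simp add: Q_def block_model_real[OF x True] algebra_simps)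
  qed (simp add: Q_def block_model_infinite[OF x e])
  then have "ereal (- C - C\<^sup>2 / (2 * m)) \<le> q"
    unfolding q_def by (rule INF_greatest)
  moreover have q_le: "q \<le> Q e" if "e \<in> block_space blk i" for e
    unfolding q_def by (rule INF_lower[OF that])
  then have "q \<le> 0"
    using Q0 subspace_0[OF subspace_block_space] by metis
  ultimately obtain r where r: "q = ereal r"
    by (cases q) auto
  have Qd: "Q d \<le> ereal ((1 - \<eta>) * r)"
    using opt by (cases "Q d") (auto simp: Q0 r algebra_simps)
  show fd: "d \<in> feasible_dirs x i"
    using Qd block_model_infinite[OF x d] by (force simp: Q_def)
  assume e: "e \<in> feasible_dirs x i"
  have "r \<le> real_decrease x i e + 1 / 2 * (e \<bullet> (M *v e))"
    using q_le[OF feasible_dirsD(1)[OF e]] by (simp add: r Q_def block_model_real[OF x e])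
  then have "(1 - \<eta>) * r \<le> (1 - \<eta>) * (real_decrease x i e + 1 / 2 * (e \<bullet> (M *v e)))"
    using \<eta> by (intro mult_left_mono) auto
  then show "real_decrease x i d + 1 / 2 * (d \<bullet> (M *v d))
       \<le> (1 - \<eta>) * (real_decrease x i e + 1 / 2 * (e \<bullet> (M *v e)))"
    using Qd by (simp add: Q_def block_model_real[OF x fd])
qed

text \<open>The competitor \<open>e = 0\<close> shows that the quadratic term at \<open>d\<close> is paid for by \<open>-\<Delta>\<close>.\<close>

lemma approx_minimizer_decrease:
  assumes x: "feasible x" and \<eta>: "0 \<le> \<eta>" "\<eta> < 1" and m: "0 < m"
    and M: "\<And>d. d \<in> block_space blk i \<Longrightarrow> m * (norm d)\<^sup>2 \<le> d \<bullet> (M *v d)"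
    and approx: "approx_minimizer blk g \<psi> \<eta> x i M d"
  shows "real_decrease x i d \<le> - (m / 2) * (norm d)\<^sup>2"
  using approx_minimizer_le(2)[OF assms zero_feasible_dir[OF x]]
    M[OF feasible_dirsD(1)[OF approx_minimizer_le(1)[OF assms]]]
  by (simp add: real_decrease_zero)

text \<open>
  Every trial step \<open>t \<le> (1 - \<gamma>) m / L\<^sub>i\<close> passes the test: the error \<open>t\<^sup>2 L\<^sub>i \<parallel>d\<parallel>\<^sup>2 / 2\<close> of the
  quadratic model is then at most the part \<open>- (1 - \<gamma>) t \<Delta>\<close> of the predicted decrease that the test
  gives away. The accepted step is the largest one that passes.
\<close>

lemma backtracking_step_bound:
  assumes x: "feasible x" and d: "d \<in> feasible_dirs x i" and m: "0 < m"
    and decrease: "real_decrease x i d \<le> - (m / 2) * (norm d)\<^sup>2"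
    and \<beta>: "0 < \<beta>" "\<beta> < 1" and \<gamma>: "\<gamma> < 1"
    and j: "\<beta> ^ j \<le> (1 - \<gamma>) * m / L i"
    and step: "backtracking_step blk f g \<psi> \<beta> \<gamma> x i d a"
  shows "\<beta> ^ j \<le> a"
proof -
  let ?t = "\<beta> ^ j"
  have t: "0 < ?t" "?t \<le> 1"
    using \<beta> by (auto intro: power_le_one)
  have "?t * L i \<le> (1 - \<gamma>) * m"
    using j L_pos[of i] by (simp add: field_simps)
  then have "?t * L i * (norm d)\<^sup>2 \<le> (1 - \<gamma>) * m * (norm d)\<^sup>2"
    by (rule mult_right_mono) simp
  moreover have "(1 - \<gamma>) * real_decrease x i d \<le> (1 - \<gamma>) * (- (m / 2) * (norm d)\<^sup>2)"
    using \<gamma> by (intro mult_left_mono[OF decrease]) simp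
  then have "real_decrease x i d \<le> \<gamma> * real_decrease x i d - (1 - \<gamma>) * m * (norm d)\<^sup>2 / 2"
    by (simp add: algebra_simps)
  ultimately have "real_decrease x i d + ?t * (L i / 2 * (norm d)\<^sup>2) \<le> \<gamma> * real_decrease x i d"
    by (simp add: mult_ac)
  then have "?t * (real_decrease x i d + ?t * (L i / 2 * (norm d)\<^sup>2)) \<le> ?t * (\<gamma> * real_decrease x i d)"
    using t by (intro mult_left_mono) auto
  then have "real_objective (x + ?t *\<^sub>R d) \<le> real_objective x + ?t * \<gamma> * real_decrease x i d"
    using real_objective_step_le[OF x d, of ?t] t by (simp add: algebra_simps power2_eq_square)
  moreover have "feasible (x + ?t *\<^sub>R d)"
    using block_step(1)[OF x real_decrease_scale(1)[OF x d]] t by simp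
  ultimately show ?thesis
    using step x d unfolding backtracking_step_def Let_def
    by (auto simp: objective_real block_decrease_real)
qed

lemma backtracking_step_result:
  assumes x: "feasible x" and d: "d \<in> feasible_dirs x i" and \<beta>: "0 < \<beta>" "\<beta> < 1"
    and step: "backtracking_step blk f g \<psi> \<beta> \<gamma> x i d a"
  shows "0 < a" "feasible (x + a *\<^sub>R d)"
    "real_objective (x + a *\<^sub>R d) \<le> real_objective x + a * \<gamma> * real_decrease x i d"
proof -
  have a: "0 < a" "a \<le> 1"
    and F: "objective blk f \<psi> (x + a *\<^sub>R d) \<le> objective blk f \<psi> x + ereal (a * \<gamma>) * block_decrease blk g \<psi> x i d"
    using step \<beta> by (auto simp: backtracking_step_def Let_def power_le_one)
  from a show "0 < a" by simp
  show feas: "feasible (x + a *\<^sub>R d)"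
    using block_step(1)[OF x real_decrease_scale(1)[OF x d]] a by simp
  show "real_objective (x + a *\<^sub>R d) \<le> real_objective x + a * \<gamma> * real_decrease x i d"
    using F by (simp add: objective_real block_decrease_real x d feas)
qed

text \<open>
  The competitor for block \<open>i\<close> is \<open>(\<tau> / w\<^sub>i) (y - x)\<^sub>i\<close>. The factor cancels the weight
  \<open>w\<^sub>i\<close> in the first-order term, so that these terms add up to at most \<open>\<tau>\<close> times
  \<open>\<nabla>f(x) \<bullet> (y - x) + \<psi>(y) - \<psi>(x)\<close>, which convexity of \<open>f\<close> bounds by \<open>\<tau> (F(y) - F(x))\<close>, and the quadratic terms to the form with
  weights \<open>1 / w\<^sub>i\<close>. The condition \<open>\<tau> \<le> w\<^sub>i\<close> keeps every competitor on the segment towards \<open>y\<close>.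
\<close>

lemma weighted_model_le:
  assumes x: "feasible x" and y: "feasible y"
    and w: "\<And>i. 0 < w i" and \<tau>: "0 \<le> \<tau>" "\<And>i. \<tau> \<le> w i"
    and form: "(\<Sum>i\<in>UNIV. 1 / w i * (block_part blk i (y - x) \<bullet> (M i *v block_part blk i (y - x))))
       \<le> K * (norm (y - x))\<^sup>2"
    and q: "\<And>i e. e \<in> feasible_dirs x i \<Longrightarrow> q i \<le> real_decrease x i e + 1 / 2 * (e \<bullet> (M i *v e))"
  shows "(\<Sum>i\<in>UNIV. w i * q i)
    \<le> \<tau> * (real_objective y - real_objective x) + \<tau>\<^sup>2 / 2 * (K * (norm (y - x))\<^sup>2)"
proof -
  let ?z = "\<lambda>i. block_part blk i (y - x)"
  have z: "?z i \<in> feasible_dirs x i" for i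
    using y by (simp add: feasible_dirs_def feasible_def block_part_diff)
       (metis block_part_diff block_part_mem)
  \<comment> \<open>\<open>w\<^sub>i\<close> times the model value at the competitor, where \<open>w\<^sub>i (\<tau> / w\<^sub>i)\<^sup>2 = \<tau>\<^sup>2 / w\<^sub>i\<close>\<close>
  have block: "w i * q i \<le> \<tau> * real_decrease x i (?z i) + \<tau>\<^sup>2 / 2 * (1 / w i * (?z i \<bullet> (M i *v ?z i)))" for i
  proof -
    let ?l = "\<tau> / w i"
    have l: "0 \<le> ?l" "?l \<le> 1"
      using \<tau> w[of i] by auto
    note e = real_decrease_scale[OF x z l]
    have "q i \<le> ?l * real_decrease x i (?z i) + 1 / 2 * (?l\<^sup>2 * (?z i \<bullet> (M i *v ?z i)))"
      using q[OF e(1)[of i]] e(2)[of i] by (simp add: matrix_vector_mult_scaleR power2_eq_square mult.assoc)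
    then have "w i * q i \<le> w i * (?l * real_decrease x i (?z i) + 1 / 2 * (?l\<^sup>2 * (?z i \<bullet> (M i *v ?z i))))"
      using w[of i] by (intro mult_left_mono) auto
    also have "\<dots> = \<tau> * real_decrease x i (?z i) + \<tau>\<^sup>2 / 2 * (1 / w i * (?z i \<bullet> (M i *v ?z i)))"
      using w[of i] by (simp add: field_simps power2_eq_square)
    finally show ?thesis .
  qed
  have "(\<Sum>i\<in>UNIV. real_decrease x i (?z i))
      = g x \<bullet> (y - x) + (\<Sum>i\<in>UNIV. real_psi i (block_part blk i y) - real_psi i (block_part blk i x))"
    by (simp add: real_decrease_def sum.distrib inner_block_sum[of "g x" _ blk] block_part_diff)
  also have "\<dots> \<le> real_objective y - real_objective x"
    using gradient_inequality[of x y] by (simp add: real_objective_def sum_subtractf)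
  finally have lin: "(\<Sum>i\<in>UNIV. real_decrease x i (?z i)) \<le> real_objective y - real_objective x" .
  have "(\<Sum>i\<in>UNIV. w i * q i) \<le> \<tau> * (\<Sum>i\<in>UNIV. real_decrease x i (?z i))
      + \<tau>\<^sup>2 / 2 * (\<Sum>i\<in>UNIV. 1 / w i * (?z i \<bullet> (M i *v ?z i)))"
    unfolding sum_distrib_left sum.distrib[symmetric] by (intro sum_mono block)
  also have "\<dots> \<le> \<tau> * (real_objective y - real_objective x) + \<tau>\<^sup>2 / 2 * (K * (norm (y - x))\<^sup>2)"
    by (intro add_mono mult_left_mono lin form) (use \<tau> in auto)
  finally show ?thesis .
qed

text \<open>
  The weights are now \<open>w\<^sub>i = \<alpha>\<^sub>i p\<^sub>i\<close>: the probability of block \<open>i\<close> times the guaranteed decrease if it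
  is sampled contributes \<open>\<gamma> w\<^sub>i \<Delta>\<^sub>i\<close>, and \<open>\<Delta>\<^sub>i\<close> is at most \<open>1 - \<eta>\<close> times the model value of any
  competitor. Growth turns \<open>\<parallel>y - x\<parallel>\<^sup>2\<close> into the gap.
\<close>

lemma expected_gap_le:
  assumes x: "feasible x" and y: "feasible y"
    and \<eta>: "0 \<le> \<eta>" "\<eta> < 1" and \<gamma>: "0 < \<gamma>" and \<beta>: "0 < \<beta>" "\<beta> < 1" and \<mu>: "0 < \<mu>"
    and p: "\<And>i. 0 < p i" "(\<Sum>i\<in>UNIV. p i) = 1"
    and m: "\<And>i. 0 < m i"
    and M: "\<And>i e. e \<in> block_space blk i \<Longrightarrow> m i * (norm e)\<^sup>2 \<le> e \<bullet> (M i *v e)"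
    and approx: "\<And>i. approx_minimizer blk g \<psi> \<eta> x i (M i) (d i)"
    and step: "\<And>i. backtracking_step blk f g \<psi> \<beta> \<gamma> x i (d i) (a i)"
    and growth: "\<mu> / 2 * (norm (y - x))\<^sup>2 \<le> real_objective x - real_objective y"
    and \<tau>: "0 \<le> \<tau>" "\<And>i. \<tau> \<le> a i * p i"
    and K: "0 \<le> K" "(\<Sum>i\<in>UNIV. 1 / (a i * p i) * (block_part blk i (y - x) \<bullet> (M i *v block_part blk i (y - x))))
       \<le> K * (norm (y - x))\<^sup>2"
  shows "(\<Sum>i\<in>UNIV. p i * (real_objective (x + a i *\<^sub>R d i) - real_objective y))
    \<le> (1 - (1 - \<eta>) * \<gamma> * (\<tau> - \<tau>\<^sup>2 * K / \<mu>)) * (real_objective x - real_objective y)"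
proof -
  let ?\<delta> = "real_objective x - real_objective y"
  have d: "d i \<in> feasible_dirs x i" for i
    by (rule approx_minimizer_le(1)[OF x \<eta> m _ approx]) (rule M)
  note moved = backtracking_step_result[OF x d \<beta> step]
  have w: "0 < a i * p i" for i
    using moved(1)[of i] p(1)[of i] by simp
  define q where "q i = real_decrease x i (d i) / (1 - \<eta>)" for i
  have "q i \<le> real_decrease x i e + 1 / 2 * (e \<bullet> (M i *v e))" if e: "e \<in> feasible_dirs x i" for i e
  proof -
    have "0 \<le> m i * (norm (d i))\<^sup>2"
      using m[of i] by simp
    then have "0 \<le> d i \<bullet> (M i *v d i)"
      using M[OF feasible_dirsD(1)[OF d], of i] by linarith
    moreover have "real_decrease x i (d i) + 1 / 2 * (d i \<bullet> (M i *v d i))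
        \<le> (1 - \<eta>) * (real_decrease x i e + 1 / 2 * (e \<bullet> (M i *v e)))"
      by (rule approx_minimizer_le(2)[OF x \<eta> m _ approx e]) (rule M)
    ultimately show ?thesis
      using \<eta> by (simp add: q_def divide_le_eq mult.commute)
  qed
  then have "(\<Sum>i\<in>UNIV. a i * p i * q i) \<le> \<tau> * (- ?\<delta>) + \<tau>\<^sup>2 / 2 * (K * (norm (y - x))\<^sup>2)"
    using weighted_model_le[OF x y, of "\<lambda>i. a i * p i" \<tau> M K q] w \<tau> K(2) by simp
  also have "(norm (y - x))\<^sup>2 \<le> 2 * ?\<delta> / \<mu>"
    using growth \<mu> by (simp add: field_simps)
  then have "\<tau>\<^sup>2 / 2 * (K * (norm (y - x))\<^sup>2) \<le> \<tau>\<^sup>2 / 2 * (K * (2 * ?\<delta> / \<mu>))"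
    using K(1) by (intro mult_left_mono) auto
  finally have "(\<Sum>i\<in>UNIV. a i * p i * q i) \<le> - (\<tau> - \<tau>\<^sup>2 * K / \<mu>) * ?\<delta>"
    using \<mu> by (simp add: field_simps)
  then have main: "(1 - \<eta>) * \<gamma> * (\<Sum>i\<in>UNIV. a i * p i * q i)
      \<le> (1 - \<eta>) * \<gamma> * (- (\<tau> - \<tau>\<^sup>2 * K / \<mu>) * ?\<delta>)"
    using \<eta> \<gamma> by (intro mult_left_mono) auto
  have ring: "u + c * (- r * u) = (1 - c * r) * u" for u c r :: real
    by (simp add: algebra_simps)
  have "p i * (real_objective (x + a i *\<^sub>R d i) - real_objective y)
      \<le> p i * ?\<delta> + (1 - \<eta>) * \<gamma> * (a i * p i * q i)" for i
  proof -
    have "p i * (real_objective (x + a i *\<^sub>R d i) - real_objective y)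
        \<le> p i * (?\<delta> + a i * \<gamma> * real_decrease x i (d i))"
      using moved(3)[of i] p(1)[of i] by (intro mult_left_mono) auto
    also have "real_decrease x i (d i) = (1 - \<eta>) * q i"
      using \<eta> by (simp add: q_def)
    also have "p i * (?\<delta> + a i * \<gamma> * ((1 - \<eta>) * q i)) = p i * ?\<delta> + (1 - \<eta>) * \<gamma> * (a i * p i * q i)"
      by (simp add: algebra_simps)
    finally show ?thesis .
  qed
  then have "(\<Sum>i\<in>UNIV. p i * (real_objective (x + a i *\<^sub>R d i) - real_objective y))
      \<le> (\<Sum>i\<in>UNIV. p i * ?\<delta> + (1 - \<eta>) * \<gamma> * (a i * p i * q i))"
    by (intro sum_mono)
  also have "\<dots> = ?\<delta> + (1 - \<eta>) * \<gamma> * (\<Sum>i\<in>UNIV. a i * p i * q i)"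
    by (simp add: sum.distrib sum_distrib_left[symmetric] sum_distrib_right[symmetric] p(2))
  also have "\<dots> \<le> ?\<delta> + (1 - \<eta>) * \<gamma> * (- (\<tau> - \<tau>\<^sup>2 * K / \<mu>) * ?\<delta>)"
    using main by (rule add_left_mono)
  also have "\<dots> = (1 - (1 - \<eta>) * \<gamma> * (\<tau> - \<tau>\<^sup>2 * K / \<mu>)) * ?\<delta>"
    by (rule ring)
  finally show ?thesis .
qed

text \<open>
  The line search never increases a finite \<open>F\<close> to \<open>\<infinity>\<close>, provided that \<open>\<Delta> < \<infinity>\<close>. The latter needs a
  finite subproblem value, for which positive definiteness of the current matrix suffices.
\<close>

lemma bcd_run_feasible:
  assumes run: "bcd_run blk f g \<psi> \<beta> \<gamma> \<eta> x p s H d \<alpha>"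
    and \<eta>: "0 \<le> \<eta>" "\<eta> < 1" and \<beta>: "0 < \<beta>" "\<beta> < 1"
  shows "feasible (x t)"
proof (induction t)
  case 0
  then show ?case
    using run by (simp add: bcd_run_def objective_finite_iff[symmetric])
next
  case (Suc t)
  let ?i = "s t"
  have approx: "approx_minimizer blk g \<psi> \<eta> (x t) ?i (H t ?i) (d t ?i)"
    and step: "backtracking_step blk f g \<psi> \<beta> \<gamma> (x t) ?i (d t ?i) (\<alpha> t ?i)"
    and posdef: "block_posdef blk ?i (H t ?i)"
    and next_point: "x (Suc t) = x t + \<alpha> t ?i *\<^sub>R d t ?i"
    using run by (simp_all add: bcd_run_def bcd_update_def)
  obtain m where "0 < m" "\<And>e. e \<in> block_space blk ?i \<Longrightarrow> m * (norm e)\<^sup>2 \<le> e \<bullet> (H t ?i *v e)"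
    using block_posdef_coercive[OF posdef] by blast
  then have "d t ?i \<in> feasible_dirs (x t) ?i"
    by (rule approx_minimizer_le(1)[OF Suc \<eta> _ _ approx])
  then show ?case
    using backtracking_step_result(2)[OF Suc _ \<beta> step] next_point by simp
qed

lemma bcd_run_step_lower_bound:
  assumes run: "bcd_run blk f g \<psi> \<beta> \<gamma> \<eta> x p s H d \<alpha>"
    and \<eta>: "0 \<le> \<eta>" "\<eta> < 1" and \<beta>: "0 < \<beta>" "\<beta> < 1" and \<gamma>: "\<gamma> < 1" and m: "\<And>i. 0 < m i"
  shows "\<exists>c>0. \<forall>t. (\<forall>i. block_psd blk i (H t i - m i *\<^sub>R mat 1)) \<longrightarrow> (\<forall>i. c \<le> \<alpha> t i)"
proof -
  have "\<exists>j. \<beta> ^ j \<le> (1 - \<gamma>) * m i / L i" for i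
    using real_arch_pow_inv[of "(1 - \<gamma>) * m i / L i" \<beta>] \<beta> \<gamma> m[of i] L_pos[of i]
    by (auto intro: less_imp_le)
  then obtain j where j: "\<And>i. \<beta> ^ j i \<le> (1 - \<gamma>) * m i / L i"
    by metis
  define c where "c = Min (range (\<lambda>i. \<beta> ^ j i))"
  have "0 < c"
    using \<beta> by (simp add: c_def)
  moreover have "c \<le> \<alpha> t i" if psd: "\<forall>i. block_psd blk i (H t i - m i *\<^sub>R mat 1)" for t i
  proof -
    have approx: "approx_minimizer blk g \<psi> \<eta> (x t) i (H t i) (d t i)"
      and step: "backtracking_step blk f g \<psi> \<beta> \<gamma> (x t) i (d t i) (\<alpha> t i)"
      using run by (simp_all add: bcd_run_def)
    have coercive: "m i * (norm e)\<^sup>2 \<le> e \<bullet> (H t i *v e)" if "e \<in> block_space blk i" for e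
      using block_psd_shift_coercive[OF _ that] psd by blast
    note sub = bcd_run_feasible[OF run \<eta> \<beta>] \<eta> m coercive approx
    have "\<beta> ^ j i \<le> \<alpha> t i"
      by (rule backtracking_step_bound[OF bcd_run_feasible[OF run \<eta> \<beta>] approx_minimizer_le(1)[OF sub]
            m approx_minimizer_decrease[OF sub] \<beta> \<gamma> j step])
    moreover have "c \<le> \<beta> ^ j i"
      by (simp add: c_def)
    ultimately show ?thesis
      by (rule order_trans[rotated])
  qed
  ultimately show ?thesis by blast
qed

end

section \<open>Expected decrease of one iteration\<close>

lemma nonneg_expectation_real:
  fixes p :: "'b::finite pmf"
  assumes "\<And>i. 0 \<le> X i"
  shows "nonneg_expectation p (\<lambda>i. ereal (X i)) = ereal (\<Sum>i\<in>UNIV. pmf p i * X i)"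
proof -
  have "(\<integral>\<^sup>+ i. e2ennreal (ereal (X i)) \<partial>measure_pmf p) = ennreal (\<integral> i. X i \<partial>measure_pmf p)"
    by (simp add: nn_integral_eq_integral integrable_measure_pmf_finite assms)
  also have "(\<integral> i. X i \<partial>measure_pmf p) = (\<Sum>i\<in>UNIV. pmf p i * X i)"
    by (subst integral_measure_pmf[of UNIV]) auto
  finally show ?thesis
    by (simp add: nonneg_expectation_def enn2ereal_ennreal sum_nonneg assms)
qed

theorem theorem2:
  fixes blk :: "'n::finite \<Rightarrow> 'b::finite"
    and f :: "real^'n \<Rightarrow> real" and g :: "real^'n \<Rightarrow> real^'n"
    and \<psi> :: "'b \<Rightarrow> real^'n \<Rightarrow> ereal"
    and L m :: "'b \<Rightarrow> real" and \<beta> \<gamma> \<eta> \<mu> :: real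
    and x :: "nat \<Rightarrow> real^'n" and p :: "nat \<Rightarrow> 'b pmf" and s :: "nat \<Rightarrow> 'b"
    and H :: "nat \<Rightarrow> 'b \<Rightarrow> real^'n^'n" and d :: "nat \<Rightarrow> 'b \<Rightarrow> real^'n"
    and \<alpha> :: "nat \<Rightarrow> 'b \<Rightarrow> real" and k :: nat
  assumes gradient: "\<And>y. GDERIV f y :> g y" "continuous_on UNIV g"
    and f_convex: "convex_on UNIV f"
    and L_pos: "\<And>i. L i > 0"
    and lipschitz: "blockwise_lipschitz blk g L"
    and psi: "\<And>i. closed_convex_proper_on (block_space blk i) (\<psi> i)"
    and bounded_below: "\<exists>c::real. \<forall>y. ereal c \<le> objective blk f \<psi> y"
    and minimizers_nonempty: "minimizers (objective blk f \<psi>) \<noteq> {}"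
    and mu_pos: "\<mu> > 0"
    and growth: "quadratic_growth (objective blk f \<psi>) \<mu>"
    and beta: "0 < \<beta>" "\<beta> < 1" and gamma: "0 < \<gamma>" "\<gamma> < 1" and eta: "0 \<le> \<eta>" "\<eta> < 1"
    and run: "bcd_run blk f g \<psi> \<beta> \<gamma> \<eta> x p s H d \<alpha>"
    and m_pos: "\<And>i. m i > 0"
    and H_lower: "\<And>i. block_psd blk i (H k i - m i *\<^sub>R mat 1)"
    and not_optimal: "objective blk f \<psi> (x k) > min_value (objective blk f \<psi>)"
  shows "(\<exists>c>0. \<forall>t. (\<forall>i. block_psd blk i (H t i - m i *\<^sub>R mat 1)) \<longrightarrow> (\<forall>i. c \<le> \<alpha> t i)) \<and>
    (let F = objective blk f \<psi>;
         Fmin = min_value F;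
         P = block_diag blk (\<lambda>i. pmf (p k) i *\<^sub>R mat 1);
         A = block_diag blk (\<lambda>i. \<alpha> k i *\<^sub>R mat 1);
         Hk = block_diag blk (H k);
         K = spectral_norm (matrix_inv P ** matrix_inv A ** Hk);
         \<pi> = Min (range (\<lambda>i. \<alpha> k i * pmf (p k) i))
     in \<exists>\<rho>::real.
          nonneg_expectation (p k) (\<lambda>i. F (bcd_update (x k) (\<alpha> k) (d k) i) - Fmin) / (F (x k) - Fmin)
            \<le> ereal (1 - (1 - \<eta>) * \<gamma> * \<rho>) \<and>
          (if \<mu> / (2 * K * \<pi>) \<le> 1
           then \<rho> \<ge> \<mu> / (4 * K)
           else \<rho> \<ge> \<pi> * (1 - \<pi> * K / \<mu>)))"
proof -
  interpret composite_problem blk f g \<psi> L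
    by standard (fact gradient(1) f_convex L_pos lipschitz psi minimizers_nonempty)+
  let ?x = "x k"
  define y where "y = closest_point (minimizers (objective blk f \<psi>)) ?x"
  have x: "feasible ?x"
    by (rule bcd_run_feasible[OF run eta beta])
  have y_min: "y \<in> minimizers (objective blk f \<psi>)"
    unfolding y_def by (rule closest_point_in_set[OF closed_minimizers minimizers_nonempty])
  note y = feasible_minimizer(1,2)[OF x y_min]
  define \<delta> where "\<delta> = real_objective ?x - real_objective y"
  have \<delta>: "0 < \<delta>"
    using not_optimal by (simp add: \<delta>_def objective_real x y)
  have growth_x: "\<mu> / 2 * (norm (y - ?x))\<^sup>2 \<le> real_objective ?x - real_objective y"
    using growth[unfolded quadratic_growth_def, rule_format, of ?x]
    by (simp add: objective_real x y y_def[symmetric] norm_minus_commute)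
  have approx: "\<And>i. approx_minimizer blk g \<psi> \<eta> ?x i (H k i) (d k i)"
    and step: "\<And>i. backtracking_step blk f g \<psi> \<beta> \<gamma> ?x i (d k i) (\<alpha> k i)"
    and p_pos: "\<And>i. 0 < pmf (p k) i"
    using run by (simp_all add: bcd_run_def)
  have p_sum: "(\<Sum>i\<in>UNIV. pmf (p k) i) = 1"
    by (rule sum_pmf_eq_1) auto
  note coercive = block_psd_shift_coercive[OF H_lower]
  have "d k i \<in> feasible_dirs ?x i" for i
    by (rule approx_minimizer_le(1)[OF x eta m_pos _ approx]) (rule coercive)
  note moved = backtracking_step_result[OF x this beta step]
  define K where "K = spectral_norm (matrix_inv (block_diag blk (\<lambda>i. pmf (p k) i *\<^sub>R mat 1))
    ** matrix_inv (block_diag blk (\<lambda>i. \<alpha> k i *\<^sub>R mat 1)) ** block_diag blk (H k))"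
  have K: "0 \<le> K"
    unfolding K_def spectral_norm_def by (intro onorm_pos_le) auto
  have form: "(\<Sum>i\<in>UNIV. 1 / (\<alpha> k i * pmf (p k) i)
      * (block_part blk i (y - ?x) \<bullet> (H k i *v block_part blk i (y - ?x)))) \<le> K * (norm (y - ?x))\<^sup>2"
    unfolding K_def
    by (rule weighted_block_form_le) (use p_pos moved(1) in \<open>auto simp: less_imp_neq[symmetric]\<close>)
  define \<pi> where "\<pi> = Min (range (\<lambda>i. \<alpha> k i * pmf (p k) i))"
  have \<pi>: "0 < \<pi>" "\<And>i. \<pi> \<le> \<alpha> k i * pmf (p k) i"
    unfolding \<pi>_def using p_pos moved(1) by auto
  define ratio where "ratio = nonneg_expectation (p k)
      (\<lambda>i. objective blk f \<psi> (bcd_update ?x (\<alpha> k) (d k) i) - min_value (objective blk f \<psi>))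
    / (objective blk f \<psi> ?x - min_value (objective blk f \<psi>))"
  have contraction: "ratio \<le> ereal (1 - (1 - \<eta>) * \<gamma> * (\<tau> - \<tau>\<^sup>2 * K / \<mu>))"
    if \<tau>: "0 \<le> \<tau>" "\<tau> \<le> \<pi>" for \<tau>
  proof -
    let ?gap = "\<lambda>i. real_objective (?x + \<alpha> k i *\<^sub>R d k i) - real_objective y"
    have "nonneg_expectation (p k)
        (\<lambda>i. objective blk f \<psi> (bcd_update ?x (\<alpha> k) (d k) i) - min_value (objective blk f \<psi>))
        = nonneg_expectation (p k) (\<lambda>i. ereal (?gap i))"
      by (simp add: bcd_update_def objective_real moved(2) y)
    also have "\<dots> = ereal (\<Sum>i\<in>UNIV. pmf (p k) i * ?gap i)"
      by (rule nonneg_expectation_real) (simp add: feasible_minimizer(3)[OF moved(2) y_min])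
    finally have "ratio = ereal ((\<Sum>i\<in>UNIV. pmf (p k) i * ?gap i) / \<delta>)"
      using \<delta> by (simp add: ratio_def objective_real x y \<delta>_def)
    moreover have "(\<Sum>i\<in>UNIV. pmf (p k) i * ?gap i)
        \<le> (1 - (1 - \<eta>) * \<gamma> * (\<tau> - \<tau>\<^sup>2 * K / \<mu>)) * \<delta>"
      unfolding \<delta>_def
      by (rule expected_gap_le[OF x y(1) eta gamma(1) beta mu_pos p_pos p_sum m_pos coercive
            approx step growth_x \<tau>(1) order_trans[OF \<tau>(2) \<pi>(2)] K form])
    ultimately show ?thesis
      using \<delta> by (simp add: pos_divide_le_eq)
  qed
  have rate: "\<exists>\<rho>. ratio \<le> ereal (1 - (1 - \<eta>) * \<gamma> * \<rho>) \<and>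
      (if \<mu> / (2 * K * \<pi>) \<le> 1 then \<rho> \<ge> \<mu> / (4 * K) else \<rho> \<ge> \<pi> * (1 - \<pi> * K / \<mu>))"
  proof (cases "\<mu> / (2 * K * \<pi>) \<le> 1")
    case True
    \<comment> \<open>the maximizer of \<open>\<tau> - \<tau>\<^sup>2 K / \<mu>\<close>; for \<open>K = 0\<close> the convention \<open>\<mu> / 0 = 0\<close> gives \<open>\<tau> = 0\<close> and rate 0\<close>
    let ?\<tau> = "\<mu> / (2 * K)"
    have "0 \<le> ?\<tau>"
      using mu_pos K by simp
    moreover have "?\<tau> \<le> \<pi>"
      using True K \<pi>(1) by (cases "K = 0") (auto simp: field_simps)
    moreover have "?\<tau> - ?\<tau>\<^sup>2 * K / \<mu> = \<mu> / (4 * K)"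
      using mu_pos by (cases "K = 0") (auto simp: field_simps power2_eq_square)
    ultimately have "ratio \<le> ereal (1 - (1 - \<eta>) * \<gamma> * (\<mu> / (4 * K)))"
      using contraction[of ?\<tau>] by metis
    with True show ?thesis
      by (intro exI[of _ "\<mu> / (4 * K)"]) simp
  next
    \<comment> \<open>the maximizer lies beyond the admissible range, so its right end \<open>\<tau> = \<pi>\<close> is taken\<close>
    case False
    moreover have "\<pi> - \<pi>\<^sup>2 * K / \<mu> = \<pi> * (1 - \<pi> * K / \<mu>)"
      by (simp add: algebra_simps power2_eq_square)
    ultimately show ?thesis
      using contraction[of \<pi>] \<pi>(1) by auto
  qed
  show ?thesis
    using bcd_run_step_lower_bound[OF run eta beta gamma(2) m_pos] rate
    unfolding Let_def ratio_def K_def \<pi>_def by (rule conjI)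
qed

end
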